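(* Let $K=\mathbb{Q}(\sqrt2,\sqrt3)$. A classical universal totally positive (definite) quadratic form over $\mathcal{O}_K$ must have at least $5$ variables.
   Context: $\mathcal{O}_K$ is the ring of integers of the totally real field $K$; $\mathcal{O}_K^+$ is the set of $\alpha\in\mathcal{O}_K$ that are totally positive, written $\alpha\succ 0$, i.e. $\sigma(\alpha)>0$ for every embedding $\sigma:K\to\mathbb{C}$. A quadratic form over $\mathcal{O}_K$ in $n$ variables is $Q(x_1,\dots,x_n)=\sum_{1\le i\le j\le n}a_{ij}x_ix_j$ with $a_{ij}\in\mathcal{O}_K$. It is totally positive definite if $Q(\gamma_1,\dots,\gamma_n)\succ0$ whenever $\gamma_1,\dots,\gamma_n\in\mathcal{O}_K$ are not all zero; classical if $a_{ij}$ is divisible by $2$ in $\mathcal{O}_K$ whenever $i\neq j$; universal if for every $\alpha\in\mathcal{O}_K^+$ there exist $\gamma_1,\dots,\gamma_n\in\mathcal{O}_K$ with $Q(\gamma_1,\dots,\gamma_n)=\alpha$. Throughout, only totally positive definite classical quadratic forms are considered. *)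

theory Defs
  imports Complex_Main "HOL-Algebra.Generated_Fields" "HOL-Algebra.Algebraic_Closure_Type"
begin

text \<open>
  A totally real number field is represented by a subfield \<^term>\<open>K\<close> of the reals (every totally
  real field has such a copy).  The notions below depend only on the field structure of
  \<^term>\<open>K\<close>: an embedding is an arbitrary ring homomorphism into the complex numbers, not
  just the given inclusion.
\<close>

definition K23 :: "real set" where
  "K23 = generate_field ring_of_type_algebra {sqrt 2, sqrt 3}"

definition ring_of_integers :: "real set \<Rightarrow> real set" where
  "ring_of_integers K = {x \<in> K. algebraic_int x}"

text \<open>Only the values of such a map on \<^term>\<open>K\<close> are relevant.  Homomorphisms of fields
  preserving \<open>1\<close> are injective.\<close>

definition embeddings :: "real set \<Rightarrow> (real \<Rightarrow> complex) set" where
  "embeddings K = ring_hom (ring_of_type_algebra\<lparr>carrier := K\<rparr>) ring_of_type_algebra"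

definition totally_positive :: "real set \<Rightarrow> real \<Rightarrow> bool" where
  "totally_positive K \<alpha> \<longleftrightarrow> (\<forall>\<sigma>\<in>embeddings K. \<sigma> \<alpha> \<in> \<real> \<and> Re (\<sigma> \<alpha>) > 0)"

definition totally_positive_integers :: "real set \<Rightarrow> real set" where
  "totally_positive_integers K = {\<alpha> \<in> ring_of_integers K. totally_positive K \<alpha>}"

text \<open>A form in \<open>n\<close> variables is given by its coefficients \<open>a i j\<close> for \<open>1 \<le> i \<le> j \<le> n\<close>; other
  values of \<open>a\<close>, and values of the argument \<open>x\<close> outside \<open>{1..n}\<close>, are ignored.\<close>

definition qform_eval :: "nat \<Rightarrow> (nat \<Rightarrow> nat \<Rightarrow> real) \<Rightarrow> (nat \<Rightarrow> real) \<Rightarrow> real" where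
  "qform_eval n a x = (\<Sum>i=1..n. \<Sum>j=i..n. a i j * x i * x j)"

definition quadratic_form_over :: "real set \<Rightarrow> nat \<Rightarrow> (nat \<Rightarrow> nat \<Rightarrow> real) \<Rightarrow> bool" where
  "quadratic_form_over K n a \<longleftrightarrow>
     (\<forall>i j. 1 \<le> i \<and> i \<le> j \<and> j \<le> n \<longrightarrow> a i j \<in> ring_of_integers K)"

definition totally_positive_definite :: "real set \<Rightarrow> nat \<Rightarrow> (nat \<Rightarrow> nat \<Rightarrow> real) \<Rightarrow> bool" where
  "totally_positive_definite K n a \<longleftrightarrow>
     (\<forall>\<gamma>. (\<forall>i\<in>{1..n}. \<gamma> i \<in> ring_of_integers K) \<and> (\<exists>i\<in>{1..n}. \<gamma> i \<noteq> 0) \<longrightarrow>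
        totally_positive K (qform_eval n a \<gamma>))"

definition classical_form :: "real set \<Rightarrow> nat \<Rightarrow> (nat \<Rightarrow> nat \<Rightarrow> real) \<Rightarrow> bool" where
  "classical_form K n a \<longleftrightarrow>
     (\<forall>i j. 1 \<le> i \<and> i < j \<and> j \<le> n \<longrightarrow> (\<exists>b\<in>ring_of_integers K. a i j = 2 * b))"

definition universal_form :: "real set \<Rightarrow> nat \<Rightarrow> (nat \<Rightarrow> nat \<Rightarrow> real) \<Rightarrow> bool" where
  "universal_form K n a \<longleftrightarrow>
     (\<forall>\<alpha>\<in>totally_positive_integers K.
        \<exists>\<gamma>. (\<forall>i\<in>{1..n}. \<gamma> i \<in> ring_of_integers K) \<and> qform_eval n a \<gamma> = \<alpha>)"

end

theory Submission
  imports Defs "Jordan_Normal_Form.Char_Poly"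
begin

text \<open>
  Let \<open>\<theta> = (\<surd>2 + \<surd>6) / 2\<close>.  A universal form represents the totally positive integers \<open>1\<close>, \<open>2 + \<theta>\<close>,
  \<open>3 + \<surd>3 - \<theta> - \<surd>2\<close>, \<open>3 + 2 \<theta> - \<surd>2\<close> and \<open>3 - \<surd>3 - \<theta> + \<surd>2\<close>,
  which have norms \<open>1, 1, 9, 9, 25\<close>.  If a classical form \<open>Q\<close> with
  bilinear form \<open>B\<close> represents \<open>\<alpha> = Q(x)\<close> and \<open>\<beta> = Q(y)\<close>, then \<open>B(x, y)\<close> is an integer and, by
  Cauchy-Schwarz at every embedding, \<open>\<alpha>\<beta> - B(x, y)\<^sup>2\<close> is totally nonnegative; this leaves
  finitely many values.  For the five integers above it forces orthogonality except between the
  last vector and the two vectors of norm 9, and none of the remaining Gram matrices is singular.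
  Hence the five vectors are linearly independent.
\<close>

section \<open>Algebraic integers form a ring\<close>

unbundle no fps_syntax

text \<open>The \<int>-module generated by the \<open>v i\<close>. Coefficients are total functions,
  so the module is a plain range.\<close>

definition int_span :: "('i \<Rightarrow> real) \<Rightarrow> 'i set \<Rightarrow> real set" where
  "int_span v I = range (\<lambda>c. \<Sum>i\<in>I. of_int (c i) * v i)"

lemma int_spanI: "a = (\<Sum>i\<in>I. of_int (c i) * v i) \<Longrightarrow> a \<in> int_span v I"
  unfolding int_span_def by (rule image_eqI[where x = c]) auto

lemma int_span_add:
  assumes "a \<in> int_span v I" "b \<in> int_span v I"
  shows "a + b \<in> int_span v I"
proof -
  obtain c d where "a = (\<Sum>i\<in>I. of_int (c i) * v i)" "b = (\<Sum>i\<in>I. of_int (d i) * v i)"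
    using assms by (auto simp: int_span_def)
  then have "a + b = (\<Sum>i\<in>I. of_int (c i + d i) * v i)"
    by (simp add: sum.distrib algebra_simps)
  then show ?thesis by (rule int_spanI)
qed

lemma int_span_scale:
  assumes "a \<in> int_span v I"
  shows "of_int k * a \<in> int_span v I"
proof -
  obtain c where "a = (\<Sum>i\<in>I. of_int (c i) * v i)"
    using assms by (auto simp: int_span_def)
  then have "of_int k * a = (\<Sum>i\<in>I. of_int (k * c i) * v i)"
    by (simp add: sum_distrib_left algebra_simps)
  then show ?thesis by (rule int_spanI)
qed

lemma int_span_zero: "0 \<in> int_span v I"
  by (rule int_spanI[where c = "\<lambda>_. 0"]) simp

lemma int_span_sum: "(\<And>j. j \<in> J \<Longrightarrow> f j \<in> int_span v I) \<Longrightarrow> sum f J \<in> int_span v I"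
  by (induction J rule: infinite_finite_induct) (auto intro: int_span_zero int_span_add)

lemma int_span_base:
  assumes "finite I" "i \<in> I"
  shows "v i \<in> int_span v I"
proof -
  have "v i = (\<Sum>j\<in>I. of_int (if j = i then 1 else 0) * v j)"
    using assms by (simp add: if_distrib[of of_int] if_distrib[of "\<lambda>x. x * _"] cong: if_cong)
  then show ?thesis by (rule int_spanI)
qed

lemma int_span_mult_closed:
  assumes "\<And>i. i \<in> I \<Longrightarrow> x * v i \<in> int_span v I" "a \<in> int_span v I"
  shows "x * a \<in> int_span v I"
proof -
  obtain c where c: "a = (\<Sum>i\<in>I. of_int (c i) * v i)"
    using assms(2) by (auto simp: int_span_def)
  have "x * a = (\<Sum>i\<in>I. of_int (c i) * (x * v i))"
    by (simp add: c sum_distrib_left mult.left_commute)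
  then show ?thesis using assms(1) by (auto intro!: int_span_sum int_span_scale)
qed

text \<open>The determinant trick: \<open>x\<close> is an eigenvalue of an integer matrix.\<close>

lemma algebraic_int_if_int_span_stable:
  fixes x :: real
  assumes fin: "finite I" and i0: "i0 \<in> I" "v i0 \<noteq> 0"
    and stable: "\<And>i. i \<in> I \<Longrightarrow> x * v i \<in> int_span v I"
  shows "algebraic_int x"
proof -
  define n where "n = card I"
  obtain h where h: "bij_betw h {0..<n} I"
    using ex_bij_betw_nat_finite[OF fin] n_def by blast
  have hI: "h i \<in> I" if "i < n" for i using h that by (auto simp: bij_betw_def)
  have "\<exists>c. x * v i = (\<Sum>j\<in>I. of_int (c j) * v j)" if "i \<in> I" for i
    using stable[OF that] unfolding int_span_def by blast
  then obtain c where c: "\<And>i. i \<in> I \<Longrightarrow> x * v i = (\<Sum>j\<in>I. of_int (c i j) * v j)"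
    by metis
  define A :: "int mat" where "A = mat n n (\<lambda>(i, j). c (h i) (h j))"
  define w where "w = vec n (v \<circ> h)"
  have A: "A \<in> carrier_mat n n" by (simp add: A_def)
  let ?A = "map_mat (of_int :: int \<Rightarrow> real) A"
  have A': "?A \<in> carrier_mat n n" using A by simp
  have w: "w \<in> carrier_vec n" by (simp add: w_def)
  obtain k where k: "k < n" "h k = i0" using h i0 by (auto simp: bij_betw_def)
  have "w $ k \<noteq> 0" using k i0 by (simp add: w_def)
  then have w0: "w \<noteq> 0\<^sub>v n" using k by auto
  have "?A *\<^sub>v w = x \<cdot>\<^sub>v w"
  proof (rule eq_vecI)
    fix i assume "i < dim_vec (x \<cdot>\<^sub>v w)"
    then have i: "i < n" by (simp add: w_def)
    have "(?A *\<^sub>v w) $ i = (\<Sum>j\<in>{0..<n}. of_int (c (h i) (h j)) * v (h j))"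
      using i A by (simp add: scalar_prod_def A_def w_def)
    also have "\<dots> = (\<Sum>j\<in>I. of_int (c (h i) j) * v j)"
      by (rule sum.reindex_bij_betw[OF h])
    also have "\<dots> = (x \<cdot>\<^sub>v w) $ i" using c[OF hI[OF i]] i by (simp add: w_def)
    finally show "(?A *\<^sub>v w) $ i = (x \<cdot>\<^sub>v w) $ i" .
  qed (use A w in auto)
  then have "eigenvalue ?A x"
    using A' w w0 unfolding eigenvalue_def eigenvector_def by auto
  then have "poly (char_poly ?A) x = 0"
    using eigenvalue_root_char_poly[OF A'] by simp
  moreover have "char_poly ?A = map_poly of_int (char_poly A)"
    by (rule of_int_hom.char_poly_hom[OF A])
  ultimately have "poly (map_poly of_int (char_poly A)) x = 0" by simp
  moreover have "monic (char_poly A)" using degree_monic_char_poly[OF A] by simp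
  ultimately show ?thesis by (auto simp: algebraic_int_altdef_ipoly)
qed

text \<open>A monic integer equation of degree \<open>m\<close> rewrites \<open>x ^ m\<close> in
  lower powers, so the powers below \<open>m\<close> span a \<int>-module stable under
  multiplication by \<open>x\<close>.\<close>

lemma algebraic_int_powers_stable:
  fixes x :: real
  assumes "algebraic_int x"
  obtains m :: nat where "m > 0" "\<And>i. i < m \<Longrightarrow> x * x ^ i \<in> int_span (\<lambda>i. x ^ i) {..<m}"
proof -
  obtain p :: "int poly" where p: "poly (map_poly of_int p) x = 0" "lead_coeff p = 1"
    using assms by (auto simp: algebraic_int_altdef_ipoly)
  define m where "m = degree p"
  \<comment> \<open>A constant monic polynomial is 1 and has no root. Positivity puts the nonzero
    generator \<open>x ^ 0\<close> into the module.\<close>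
  have m0: "m > 0"
  proof (rule ccontr)
    assume "\<not> m > 0"
    then have "degree p = 0" by (simp add: m_def)
    then obtain a where "p = [:a:]" by (rule degree_eq_zeroE)
    with p show False by simp
  qed
  have "0 = (\<Sum>i\<le>m. of_int (coeff p i) * x ^ i)"
    using p(1) by (simp add: poly_altdef m_def)
  also have "\<dots> = (\<Sum>i<m. of_int (coeff p i) * x ^ i) + x ^ m"
    using p(2) by (simp add: m_def lessThan_Suc_atMost[symmetric])
  finally have "x ^ m = of_int (-1) * (\<Sum>i<m. of_int (coeff p i) * x ^ i)" by simp
  moreover have "(\<Sum>i<m. of_int (coeff p i) * x ^ i) \<in> int_span (\<lambda>i. x ^ i) {..<m}"
    unfolding int_span_def by blast
  ultimately have top: "x ^ m \<in> int_span (\<lambda>i. x ^ i) {..<m}"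
    using int_span_scale by metis
  have "x * x ^ i \<in> int_span (\<lambda>i. x ^ i) {..<m}" if "i < m" for i
  proof (cases "Suc i < m")
    case True
    then show ?thesis using int_span_base[of "{..<m}" "Suc i" "\<lambda>i. x ^ i"] by simp
  next
    case False
    then have "Suc i = m" using that by simp
    then show ?thesis using top by (metis power_Suc)
  qed
  then show thesis using that m0 by blast
qed

text \<open>The products \<open>x ^ i * y ^ j\<close> span a module stable under both
  \<open>x\<close> and \<open>y\<close>, hence under their sum and product; the determinant trick
  then applies to each.\<close>

lemma algebraic_int_add_mult:
  fixes x y :: real
  assumes "algebraic_int x" "algebraic_int y"
  shows algebraic_int_add: "algebraic_int (x + y)"
    and algebraic_int_mult: "algebraic_int (x * y)"
proof -
  obtain m where m: "m > 0" "\<And>i. i < m \<Longrightarrow> x * x ^ i \<in> int_span (\<lambda>i. x ^ i) {..<m}"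
    using algebraic_int_powers_stable[OF assms(1)] by blast
  obtain n where n: "n > 0" "\<And>i. i < n \<Longrightarrow> y * y ^ i \<in> int_span (\<lambda>i. y ^ i) {..<n}"
    using algebraic_int_powers_stable[OF assms(2)] by blast
  define I where "I = {..<m} \<times> {..<n}"
  define v where "v = (\<lambda>(i, j). x ^ i * y ^ j)"
  have fin: "finite I" by (simp add: I_def)
  have vI: "x ^ i * y ^ j \<in> int_span v I" if "i < m" "j < n" for i j
    using int_span_base[OF fin, of "(i, j)" v] that by (simp add: I_def v_def)
  have X: "x * v k \<in> int_span v I" if kI: "k \<in> I" for k
  proof -
    obtain i j where k: "k = (i, j)" "i < m" "j < n" using kI by (auto simp: I_def)
    obtain c where c: "x * x ^ i = (\<Sum>l<m. of_int (c l) * x ^ l)"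
      using m(2)[OF k(2)] by (auto simp: int_span_def)
    have "x * v k = (x * x ^ i) * y ^ j" by (simp add: k v_def)
    also have "\<dots> = (\<Sum>l<m. of_int (c l) * (x ^ l * y ^ j))"
      unfolding c by (simp add: sum_distrib_right mult.assoc)
    finally show ?thesis using k vI by (auto intro!: int_span_sum int_span_scale)
  qed
  have Y: "y * v k \<in> int_span v I" if kI: "k \<in> I" for k
  proof -
    obtain i j where k: "k = (i, j)" "i < m" "j < n" using kI by (auto simp: I_def)
    obtain c where c: "y * y ^ j = (\<Sum>l<n. of_int (c l) * y ^ l)"
      using n(2)[OF k(3)] by (auto simp: int_span_def)
    have "y * v k = x ^ i * (y * y ^ j)" by (simp add: k v_def)
    also have "\<dots> = (\<Sum>l<n. of_int (c l) * (x ^ i * y ^ l))"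
      unfolding c by (simp add: sum_distrib_left mult.left_commute)
    finally show ?thesis using k vI by (auto intro!: int_span_sum int_span_scale)
  qed
  have v0: "(0, 0) \<in> I" "v (0, 0) \<noteq> 0" using m n by (auto simp: I_def v_def)
  show "algebraic_int (x + y)"
  proof (rule algebraic_int_if_int_span_stable[where I = I and v = v, OF fin v0])
    fix k assume "k \<in> I"
    then show "(x + y) * v k \<in> int_span v I"
      using int_span_add[OF X Y] by (simp add: distrib_right)
  qed
  show "algebraic_int (x * y)"
  proof (rule algebraic_int_if_int_span_stable[where I = I and v = v, OF fin v0])
    fix k assume "k \<in> I"
    then show "x * y * v k \<in> int_span v I"
      using int_span_mult_closed[of I x v, OF X Y] by (simp add: mult.assoc)
  qed
qed

section \<open>The field \<open>\<rat>(\<surd>2, \<surd>3)\<close> and its embeddings\<close>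

lemma in_Ints_if_square_in_Ints:
  fixes x :: real
  assumes "x \<in> \<rat>" "x\<^sup>2 \<in> \<int>"
  shows "x \<in> \<int>"
proof -
  have "algebraic_int (x\<^sup>2)" using assms(2) by (auto simp: int_imp_algebraic_int)
  then have "algebraic_int (sqrt (x\<^sup>2))" by (rule algebraic_int_sqrt)
  then have "algebraic_int x" by simp
  then show ?thesis using assms(1) by (rule rational_algebraic_int_is_int)
qed

lemma sqrt_irrational:
  assumes "\<And>k :: int. k\<^sup>2 \<noteq> int n"
  shows "sqrt (real n) \<notin> \<rat>"
proof
  assume "sqrt (real n) \<in> \<rat>"
  then have "sqrt (real n) \<in> \<int>" by (rule in_Ints_if_square_in_Ints) simp
  then obtain k :: int where "sqrt (real n) = of_int k" by (auto elim: Ints_cases)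
  then have "real n = of_int (k\<^sup>2)" by (metis of_int_power of_nat_0_le_iff real_sqrt_pow2)
  then have "int n = k\<^sup>2" by linarith
  then show False using assms by metis
qed

text \<open>Serves to exclude 2, 3 and 6 as squares: they lie below 9 and differ from 0, 1 and
  4.\<close>

lemma int_square_cases: "k\<^sup>2 \<in> {0, 1, 4} \<or> k\<^sup>2 \<ge> 9" for k :: int
proof (cases "\<bar>k\<bar> \<ge> 3")
  case True
  then have "3\<^sup>2 \<le> \<bar>k\<bar>\<^sup>2" by (intro power_mono) auto
  then show ?thesis by simp
next
  case False
  then have "k \<in> {-2, -1, 0, 1, 2}" by auto
  then show ?thesis by auto
qed

lemma irrational_sqrts: "sqrt 2 \<notin> \<rat>" "sqrt 3 \<notin> \<rat>" "sqrt 6 \<notin> \<rat>"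
proof -
  have *: "k\<^sup>2 \<noteq> int n" if "n \<in> {2, 3, 6}" for k :: int and n
    using that int_square_cases[of k] by auto
  show "sqrt 2 \<notin> \<rat>" "sqrt 3 \<notin> \<rat>" "sqrt 6 \<notin> \<rat>"
    using sqrt_irrational[of 2, OF *] sqrt_irrational[of 3, OF *] sqrt_irrational[of 6, OF *]
    by simp_all
qed

lemma sqrt_rat_lincomb_zero:
  assumes "sqrt r \<notin> \<rat>" "of_rat a + of_rat b * sqrt r = 0"
  shows "a = 0 \<and> b = 0"
proof (cases "b = 0")
  case False
  then have "sqrt r = of_rat (- a / b)"
    using assms(2) by (simp add: of_rat_divide of_rat_minus field_simps add_eq_0_iff)
  then show ?thesis using assms(1) by (metis Rats_of_rat)
qed (use assms in simp)

text \<open>Rational coordinates in 1, \<open>u\<close>, \<open>v\<close>, \<open>u * v\<close>.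
  Since \<open>u\<close> and \<open>v\<close> are parameters, the same four rationals describe a
  number at \<surd>2, \<surd>3 and its conjugates at the other signs.\<close>

definition rat_comb :: "real \<Rightarrow> real \<Rightarrow> rat \<Rightarrow> rat \<Rightarrow> rat \<Rightarrow> rat \<Rightarrow> real" where
  "rat_comb u v a b c d = of_rat a + of_rat b * u + of_rat c * v + of_rat d * (u * v)"

lemma rat_comb_add: "rat_comb u v a b c d + rat_comb u v a' b' c' d' = rat_comb u v (a + a') (b + b') (c + c') (d + d')"
  by (simp add: rat_comb_def of_rat_add algebra_simps)

lemma rat_comb_uminus: "- rat_comb u v a b c d = rat_comb u v (- a) (- b) (- c) (- d)"
  by (simp add: rat_comb_def of_rat_minus algebra_simps)

lemma rat_comb_mult:
  assumes "u\<^sup>2 = 2" "v\<^sup>2 = 3"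
  shows "rat_comb u v a b c d * rat_comb u v a' b' c' d' =
    rat_comb u v (a * a' + 2 * b * b' + 3 * c * c' + 6 * d * d')
           (a * b' + b * a' + 3 * (c * d' + d * c'))
           (a * c' + c * a' + 2 * (b * d' + d * b'))
           (a * d' + d * a' + b * c' + c * b')"
proof -
  have "u * u = 2" "v * v = 3" using assms by (simp_all add: power2_eq_square)
  then have uv: "u * (u * z) = 2 * z" "v * (v * z) = 3 * z" for z
    by (simp_all add: mult.assoc[symmetric])
  show ?thesis
    unfolding rat_comb_def using \<open>u * u = 2\<close> \<open>v * v = 3\<close>
    by (simp add: of_rat_add of_rat_mult algebra_simps uv)
qed

text \<open>Group the sum as A + B \<surd>3 with A and B in \<rat>(\<surd>2). If B \<noteq> 0, then
  \<surd>3 = p + q \<surd>2 with rational p and q; squaring gives p q = 0, which makes \<surd>3 or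
  \<surd>6 rational.\<close>

lemma rat_comb_sqrt_zero:
  assumes "rat_comb (sqrt 2) (sqrt 3) a b c d = 0"
  shows "a = 0 \<and> b = 0 \<and> c = 0 \<and> d = 0"
proof -
  define B :: real where "B = of_rat c + of_rat d * sqrt 2"
  have AB: "of_rat a + of_rat b * sqrt 2 + B * sqrt 3 = 0"
    using assms by (simp add: rat_comb_def B_def algebra_simps)
  show ?thesis
  proof (cases "B = 0")
    case True
    then show ?thesis
      using AB sqrt_rat_lincomb_zero[OF irrational_sqrts(1)] by (auto simp: B_def)
  next
    case False
    \<comment> \<open>\<open>n\<close> is the norm of \<open>B\<close> from \<rat>(\<surd>2) to
      \<rat>; \<open>p\<close> and \<open>q\<close> are the coordinates of -A / B after
      rationalising the denominator.\<close>
    define n where "n = c\<^sup>2 - 2 * d\<^sup>2"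
    define p where "p = - (a * c - 2 * b * d) / n"
    define q where "q = - (b * c - a * d) / n"
    have BB: "of_rat n = B * (of_rat c - of_rat d * sqrt 2)"
      by (simp add: n_def B_def of_rat_diff of_rat_mult of_rat_power algebra_simps power2_eq_square)
    have cd0: "of_rat c - of_rat d * sqrt 2 \<noteq> 0"
    proof
      assume "of_rat c - of_rat d * sqrt 2 = 0"
      then have "of_rat c + of_rat (- d) * sqrt 2 = 0" by (simp add: of_rat_minus)
      then show False using sqrt_rat_lincomb_zero[OF irrational_sqrts(1), of c "- d"] False
        by (simp add: B_def)
    qed
    have n0: "of_rat n \<noteq> (0 :: real)" using BB cd0 False by simp
    have "B * sqrt 3 = - (of_rat a + of_rat b * sqrt 2)" using AB by linarith
    then have "of_rat n * sqrt 3 = - (of_rat a + of_rat b * sqrt 2) * (of_rat c - of_rat d * sqrt 2)"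
      unfolding BB by (metis mult.assoc mult.commute)
    also have "\<dots> = of_rat (- (a * c - 2 * b * d)) + of_rat (- (b * c - a * d)) * sqrt 2"
      by (simp add: of_rat_diff of_rat_mult of_rat_minus of_rat_add algebra_simps)
    finally have s3: "sqrt 3 = of_rat p + of_rat q * sqrt 2"
      using n0 by (simp add: p_def q_def of_rat_divide of_rat_minus field_simps)
    then have "(sqrt 3)\<^sup>2 = (of_rat p + of_rat q * sqrt 2)\<^sup>2" by simp
    then have "of_rat (p\<^sup>2 + 2 * q\<^sup>2 - 3) + of_rat (2 * p * q) * sqrt 2 = 0"
      by (simp add: power2_eq_square of_rat_diff of_rat_mult of_rat_add algebra_simps)
    then have "p = 0 \<or> q = 0" using sqrt_rat_lincomb_zero[OF irrational_sqrts(1)] by fastforce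
    then show ?thesis
    proof
      assume "q = 0"
      then show ?thesis using s3 irrational_sqrts(2) by simp
    next
      assume "p = 0"
      then have "sqrt 3 * sqrt 2 = of_rat q * (sqrt 2 * sqrt 2)" using s3 by simp
      then have "sqrt 6 = of_rat (2 * q)" by (simp add: real_sqrt_mult[symmetric] of_rat_mult)
      then show ?thesis using irrational_sqrts(3) by (metis Rats_of_rat)
    qed
  qed
qed

lemma rat_comb_sqrt_eq_iff:
  "rat_comb (sqrt 2) (sqrt 3) a b c d = rat_comb (sqrt 2) (sqrt 3) a' b' c' d' \<longleftrightarrow>
    a = a' \<and> b = b' \<and> c = c' \<and> d = d'"
proof
  assume "rat_comb (sqrt 2) (sqrt 3) a b c d = rat_comb (sqrt 2) (sqrt 3) a' b' c' d'"
  then have "rat_comb (sqrt 2) (sqrt 3) (a - a') (b - b') (c - c') (d - d') = 0"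
    by (simp add: rat_comb_def of_rat_diff algebra_simps)
  then show "a = a' \<and> b = b' \<and> c = c' \<and> d = d'" using rat_comb_sqrt_zero by fastforce
qed simp

text \<open>The denominator is rationalised in two stages: the conjugate \<open>y\<close> over
  \<rat>(\<surd>2) leads to P + Q \<surd>2, and the factor P - Q \<surd>2 then leads to the rational
  norm \<open>n\<close>.\<close>

lemma rat_comb_sqrt_inverse:
  assumes "rat_comb (sqrt 2) (sqrt 3) a b c d \<noteq> 0"
  shows "\<exists>a' b' c' d'. inverse (rat_comb (sqrt 2) (sqrt 3) a b c d) = rat_comb (sqrt 2) (sqrt 3) a' b' c' d'"
proof -
  let ?rat_comb = "rat_comb (sqrt 2) (sqrt 3)"
  define P where "P = a\<^sup>2 + 2 * b\<^sup>2 - 3 * c\<^sup>2 - 6 * d\<^sup>2"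
  define Q where "Q = 2 * a * b - 6 * c * d"
  define n where "n = P\<^sup>2 - 2 * Q\<^sup>2"
  define x y where "x = ?rat_comb a b c d" and "y = ?rat_comb a b (- c) (- d)"
  have y0: "y \<noteq> 0" using assms rat_comb_sqrt_zero[of a b "- c" "- d"] by (auto simp: y_def rat_comb_def)
  have xy: "x * y = ?rat_comb P Q 0 0"
    unfolding x_def y_def by (simp add: rat_comb_mult P_def Q_def power2_eq_square algebra_simps)
  then have "?rat_comb P Q 0 0 \<noteq> 0" using assms y0 by (metis mult_eq_0_iff x_def)
  then have z0: "?rat_comb P (- Q) 0 0 \<noteq> 0" using rat_comb_sqrt_zero[of P "- Q" 0 0] by (auto simp: rat_comb_def)
  have n: "x * (y * ?rat_comb P (- Q) 0 0) = of_rat n"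
    unfolding mult.assoc[symmetric] xy
    by (simp add: rat_comb_mult n_def power2_eq_square algebra_simps) (simp add: rat_comb_def)
  then have n0: "of_rat n \<noteq> (0 :: real)"
    using assms y0 z0 unfolding x_def by (metis mult_eq_0_iff)
  have "inverse x = y * ?rat_comb P (- Q) 0 0 * ?rat_comb (1 / n) 0 0 0"
    using n n0 assms unfolding x_def[symmetric]
    by (simp add: rat_comb_def[of _ _ "1 / n"] of_rat_divide field_simps)
  then show ?thesis unfolding x_def y_def by (simp add: rat_comb_mult) blast
qed

section \<open>The generated field inside the reals\<close>

abbreviation RR :: "real ring" where "RR \<equiv> ring_of_type_algebra"

lemma RR_field: "field RR" by (rule field_from_type_algebra)

lemma ring_of_type_algebra_simps [simp]:
  "carrier ring_of_type_algebra = UNIV"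
  "x \<oplus>\<^bsub>ring_of_type_algebra\<^esub> y = x + y"
  "x \<otimes>\<^bsub>ring_of_type_algebra\<^esub> y = x * y"
  "\<one>\<^bsub>ring_of_type_algebra\<^esub> = 1"
  "\<zero>\<^bsub>ring_of_type_algebra\<^esub> = 0"
  by (simp_all add: ring_of_type_algebra_def)

lemma RR_minus: "\<ominus>\<^bsub>RR\<^esub> x = - x"
proof -
  interpret field RR by (rule RR_field)
  show ?thesis by (rule minus_equality) auto
qed

lemma RR_inv: "x \<noteq> 0 \<Longrightarrow> inv\<^bsub>RR\<^esub> x = inverse x"
proof -
  assume x: "x \<noteq> 0"
  interpret field RR by (rule RR_field)
  show ?thesis by (rule comm_inv_char) (use x in auto)
qed

lemma K23_closed:
  "x \<in> K23 \<Longrightarrow> y \<in> K23 \<Longrightarrow> x + y \<in> K23"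
  "x \<in> K23 \<Longrightarrow> y \<in> K23 \<Longrightarrow> x * y \<in> K23"
  "x \<in> K23 \<Longrightarrow> - x \<in> K23"
  "x \<in> K23 \<Longrightarrow> x \<noteq> 0 \<Longrightarrow> inverse x \<in> K23"
  "1 \<in> K23" "sqrt 2 \<in> K23" "sqrt 3 \<in> K23"
  unfolding K23_def
  using generate_field.eng_add[of x RR _ y] generate_field.eng_mult[of x RR _ y]
    generate_field.a_inv[of x RR] generate_field.m_inv[of x RR] generate_field.one[of RR]
  by (auto simp: RR_minus RR_inv intro: generate_field.incl)

lemma K23_zero: "0 \<in> K23"
  using K23_closed(1)[OF K23_closed(5) K23_closed(3)[OF K23_closed(5)]] by simp

lemma K23_of_nat: "of_nat n \<in> K23"
  by (induction n) (auto intro: K23_zero K23_closed)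

lemma K23_of_int: "of_int n \<in> K23"
  by (cases n) (use K23_of_nat K23_closed(3) in \<open>force simp del: of_nat_Suc\<close>)+

text \<open>The numbers with rational coordinates contain both generators and are closed under the
  field operations, so rule induction over the generated field suffices.\<close>

lemma K23_rat_comb:
  assumes "x \<in> K23"
  obtains a b c d where "x = rat_comb (sqrt 2) (sqrt 3) a b c d"
proof -
  have "\<exists>a b c d. x = rat_comb (sqrt 2) (sqrt 3) a b c d"
    using assms unfolding K23_def
  proof (induction rule: generate_field.induct)
    case one
    show ?case by (rule exI[of _ 1], (rule exI[of _ 0])+) (simp add: rat_comb_def)
  next
    case (incl h)
    have "sqrt 2 = rat_comb (sqrt 2) (sqrt 3) 0 1 0 0" "sqrt 3 = rat_comb (sqrt 2) (sqrt 3) 0 0 1 0"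
      by (simp_all add: rat_comb_def)
    then show ?case using incl by blast
  next
    case (a_inv h)
    then show ?case by (auto simp: RR_minus rat_comb_uminus rat_comb_sqrt_eq_iff)
  next
    case (m_inv h)
    then show ?case using rat_comb_sqrt_inverse by (auto simp: RR_inv)
  next
    case (eng_add h1 h2)
    then show ?case by (auto simp: rat_comb_add rat_comb_sqrt_eq_iff)
  next
    case (eng_mult h1 h2)
    then show ?case by (auto simp: rat_comb_mult rat_comb_sqrt_eq_iff)
  qed
  then show thesis using that by blast
qed

text \<open>The embedding \<open>\<surd>2 \<mapsto> u\<close>, \<open>\<surd>3 \<mapsto> v\<close>; it is meaningful on \<^const>\<open>K23\<close> only.\<close>

definition conj_at :: "real \<Rightarrow> real \<Rightarrow> real \<Rightarrow> real" where
  "conj_at u v x = (THE y. \<exists>a b c d. x = rat_comb (sqrt 2) (sqrt 3) a b c d \<and> y = rat_comb u v a b c d)"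

lemma conj_at_rat_comb: "conj_at u v (rat_comb (sqrt 2) (sqrt 3) a b c d) = rat_comb u v a b c d"
  unfolding conj_at_def by (rule the_equality) (auto simp: rat_comb_sqrt_eq_iff)

text \<open>The two equations leave exactly the four sign choices for \<surd>2 and \<surd>3, that
  is, the Galois group of the field.\<close>

locale conjugation =
  fixes u v :: real
  assumes u: "u\<^sup>2 = 2" and v: "v\<^sup>2 = 3"
begin

lemma conj_at_add: "x \<in> K23 \<Longrightarrow> y \<in> K23 \<Longrightarrow> conj_at u v (x + y) = conj_at u v x + conj_at u v y"
  by (elim K23_rat_comb) (simp add: rat_comb_add conj_at_rat_comb)

lemma conj_at_mult: "x \<in> K23 \<Longrightarrow> y \<in> K23 \<Longrightarrow> conj_at u v (x * y) = conj_at u v x * conj_at u v y"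
  by (elim K23_rat_comb) (simp add: rat_comb_mult[OF u v] rat_comb_mult[of "sqrt 2" "sqrt 3"] conj_at_rat_comb)

lemma conj_at_of_rat: "conj_at u v (of_rat r) = of_rat r"
  using conj_at_rat_comb[of u v r 0 0 0] by (simp add: rat_comb_def)

lemma conj_at_of_int: "conj_at u v (of_int n) = of_int n"
  using conj_at_of_rat[of "of_int n"] by simp

lemma conj_at_embedding: "(\<lambda>x. complex_of_real (conj_at u v x)) \<in> embeddings K23"
  unfolding embeddings_def using conj_at_of_int[of 1]
  by (intro ring_hom_memI) (auto simp: conj_at_add conj_at_mult)

lemma conj_at_algebraic_int:
  assumes x: "x \<in> K23" and "algebraic_int x"
  shows "algebraic_int (conj_at u v x)"
proof -
  \<comment> \<open>Membership in \<open>K23\<close> is carried through the induction because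
    \<open>conj_at\<close> is known to be additive and multiplicative only there.\<close>
  have *: "poly (map_poly of_int p) x \<in> K23 \<and>
      conj_at u v (poly (map_poly of_int p) x) = poly (map_poly of_int p) (conj_at u v x)" for p :: "int poly"
    by (induction p)
      (use conj_at_of_int[of 0] in \<open>simp_all add: map_poly_pCons K23_zero K23_closed K23_of_int x
         conj_at_add conj_at_mult conj_at_of_int\<close>)
  obtain p :: "int poly" where p: "poly (map_poly of_int p) x = 0" "lead_coeff p = 1"
    using assms(2) by (auto simp: algebraic_int_altdef_ipoly)
  have "poly (map_poly of_int p) (conj_at u v x) = 0"
    using *[of p] p(1) conj_at_of_int[of 0] by simp
  then show ?thesis using p(2) by (auto simp: algebraic_int_altdef_ipoly)
qed

end

lemma sign_conjugation [intro, simp]: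
  "conjugation (sqrt 2) (sqrt 3)" "conjugation (- sqrt 2) (sqrt 3)"
  "conjugation (sqrt 2) (- sqrt 3)" "conjugation (- sqrt 2) (- sqrt 3)"
  by unfold_locales auto

lemma rat_comb_algebraic_int:
  assumes "algebraic_int (rat_comb (sqrt 2) (sqrt 3) a b c d)"
    and "rat_comb (sqrt 2) (sqrt 3) a b c d \<in> K23" "conjugation u v"
  shows "algebraic_int (rat_comb u v a b c d)"
  using conjugation.conj_at_algebraic_int[OF assms(3,2,1)] by (simp add: conj_at_rat_comb)

section \<open>The ring of integers\<close>

lemma of_rat_in_Ints_iff: "(of_rat r :: real) \<in> \<int> \<longleftrightarrow> r \<in> \<int>"
  by (metis Ints_cases Ints_of_int of_rat_eq_iff of_rat_of_int_eq)

lemma rat_algebraic_int: "algebraic_int (of_rat r :: real) \<Longrightarrow> r \<in> \<int>"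
  using rational_algebraic_int_is_int[of "of_rat r :: real"] by (simp add: of_rat_in_Ints_iff)

section \<open>Integrality in the three quadratic subfields\<close>

lemma square_mod_4: "m\<^sup>2 mod 4 = (if even m then 0 else 1)" for m :: int
proof (cases "even m")
  case True
  then obtain k where "m = 2 * k" by blast
  then have "m\<^sup>2 = 4 * k\<^sup>2" by simp
  then show ?thesis using True by simp
next
  case False
  then obtain k where "m = 2 * k + 1" by (rule oddE)
  then have "m\<^sup>2 = 4 * (k\<^sup>2 + k) + 1" by (simp add: power2_eq_square algebra_simps)
  then show ?thesis using False by presburger
qed

text \<open>Each \<open>D\<close> is 2 or 3 modulo 4 while squares are 0 or 1, so the congruence
  forces both squares to be 0 modulo 4.\<close>

lemma even_if_squares_cong:
  fixes m n :: int
  assumes D: "D \<in> {2, 3, 6}" and dvd: "4 dvd m\<^sup>2 - D * n\<^sup>2"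
  shows "even m \<and> even n"
proof -
  define M N where "M = m\<^sup>2" and "N = n\<^sup>2"
  have MN: "M mod 4 = (if even m then 0 else 1)" "N mod 4 = (if even n then 0 else 1)"
    unfolding M_def N_def by (rule square_mod_4)+
  have "4 dvd M - D * N" using dvd by (simp add: M_def N_def)
  then have "4 dvd M - 2 * N \<or> 4 dvd M - 3 * N \<or> 4 dvd M - 6 * N" using D by auto
  then show ?thesis using MN by (cases "even m"; cases "even n") (simp_all, presburger+)
qed

text \<open>The hypotheses say that e + f \<surd>D has integral trace and norm. As \<open>D\<close>
  is squarefree, \<open>2 * f\<close> is an integer too; as \<open>D\<close> is 2 or 3 modulo 4,
  both numerators over 2 are even.\<close>

lemma quadratic_rational_int:
  fixes e f :: rat
  assumes D: "D \<in> {2, 3, 6 :: int}" and "2 * e \<in> \<int>" "e\<^sup>2 - of_int D * f\<^sup>2 \<in> \<int>"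
  shows "e \<in> \<int> \<and> f \<in> \<int>"
proof -
  obtain m where m: "2 * e = of_int m" using assms(2) by (auto elim: Ints_cases)
  obtain w where w: "e\<^sup>2 - of_int D * f\<^sup>2 = of_int w" using assms(3) by (auto elim: Ints_cases)
  have Df: "of_int D * (2 * f)\<^sup>2 = (of_int (m\<^sup>2 - 4 * w) :: rat)"
    using w m[symmetric] by (simp add: power_mult_distrib algebra_simps)
  then have sq: "(of_int D * (2 * f))\<^sup>2 = (of_int (D * (m\<^sup>2 - 4 * w)) :: rat)"
    by (simp add: power2_eq_square mult_ac)
  have "(of_rat (of_int D * (2 * f)) :: real)\<^sup>2 = of_rat ((of_int D * (2 * f))\<^sup>2)"
    by (rule of_rat_power[symmetric])
  also have "\<dots> = of_int (D * (m\<^sup>2 - 4 * w))" by (simp only: sq of_rat_of_int_eq)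
  finally have "(of_rat (of_int D * (2 * f)) :: real)\<^sup>2 \<in> \<int>" by (simp only: Ints_of_int)
  then have "(of_rat (of_int D * (2 * f)) :: real) \<in> \<int>"
    by (rule in_Ints_if_square_in_Ints[OF Rats_of_rat])
  then have "of_int D * (2 * f) \<in> \<int>" unfolding of_rat_in_Ints_iff .
  then obtain k where k: "of_int D * (2 * f) = of_int k" by (rule Ints_cases)
  have "of_int (k\<^sup>2) = (of_int (D * (m\<^sup>2 - 4 * w)) :: rat)"
    using sq by (simp only: k of_int_power)
  then have kk: "k\<^sup>2 = D * (m\<^sup>2 - 4 * w)" by (simp only: of_int_eq_iff)
  \<comment> \<open>\<open>D\<close> divides the square of \<open>k\<close>, and \<open>D\<close> is
    squarefree: its prime divisors 2 and 3 are treated separately.\<close>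
  have "D dvd k"
  proof -
    have p: "p dvd k" if "prime p" "p dvd D" for p :: int
      using kk that prime_dvd_power[of p k 2] by (metis dvd_mult2)
    have "2 dvd D \<Longrightarrow> 2 dvd k" "3 dvd D \<Longrightarrow> 3 dvd k" using p[of 2] p[of 3] by auto
    moreover have "6 dvd k" if "2 dvd k" "3 dvd k" using that by presburger
    ultimately show ?thesis using D by auto
  qed
  then obtain n where n: "k = D * n" by blast
  have D0: "D \<noteq> 0" using D by auto
  have f: "2 * f = of_int n" using k D0 by (simp add: n)
  have "of_int (D * n\<^sup>2) = (of_int (m\<^sup>2 - 4 * w) :: rat)"
    using Df by (simp only: f of_int_mult of_int_power)
  then have "D * n\<^sup>2 = m\<^sup>2 - 4 * w" by (simp only: of_int_eq_iff)
  then have "4 dvd m\<^sup>2 - D * n\<^sup>2" by simp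
  then have "even m \<and> even n" by (rule even_if_squares_cong[OF D])
  then obtain m' n' where "m = 2 * m'" "n = 2 * n'" by blast
  then have "e = of_int m'" "f = of_int n'" using m f by simp_all
  then show ?thesis by simp
qed

text \<open>Trace and norm of the conjugate pair are rational algebraic integers, hence integers.
  Either root may serve as \<open>x\<close>, so \<surd>6 can enter as \<open>u * v\<close>.\<close>

lemma quadratic_algebraic_int:
  fixes e f :: rat and x :: real
  assumes D: "D \<in> {2, 3, 6 :: int}"
    and "algebraic_int (of_rat e + of_rat f * x)" "algebraic_int (of_rat e - of_rat f * x)"
    and x: "x\<^sup>2 = of_int D"
  shows "e \<in> \<int> \<and> f \<in> \<int>"
proof (rule quadratic_rational_int[OF D])
  have "algebraic_int (of_rat (2 * e) :: real)"
    using algebraic_int_add[OF assms(2,3)] by (simp add: of_rat_mult)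
  then show "2 * e \<in> \<int>" by (rule rat_algebraic_int)
  have "(of_rat e + of_rat f * x) * (of_rat e - of_rat f * x) =
      (of_rat e)\<^sup>2 - (of_rat f)\<^sup>2 * x\<^sup>2"
    by (simp add: power2_eq_square algebra_simps)
  then have "algebraic_int ((of_rat e)\<^sup>2 - (of_rat f)\<^sup>2 * x\<^sup>2)"
    using algebraic_int_mult[OF assms(2,3)] by simp
  then have "algebraic_int (of_rat (e\<^sup>2 - of_int D * f\<^sup>2) :: real)"
    unfolding x by (simp add: of_rat_diff of_rat_mult of_rat_power mult.commute)
  then show "e\<^sup>2 - of_int D * f\<^sup>2 \<in> \<int>" by (rule rat_algebraic_int)
qed

text \<open>At \<open>u = \<surd>2\<close>, \<open>v = \<surd>3\<close> this is an integral combination of the integral basis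
  \<open>1, \<surd>3, \<theta>, \<surd>2\<close>, in this order.\<close>

definition int_comb :: "real \<Rightarrow> real \<Rightarrow> int \<Rightarrow> int \<Rightarrow> int \<Rightarrow> int \<Rightarrow> real" where
  "int_comb u v p r s t = of_int p + of_int r * v + of_int s * ((u + u * v) / 2) + of_int t * u"

lemma int_comb_rat_comb: "int_comb u v p r s t = rat_comb u v (of_int p) (of_int t + of_int s / 2) (of_int r) (of_int s / 2)"
  by (simp add: int_comb_def rat_comb_def of_rat_add of_rat_divide algebra_simps add_divide_distrib)

text \<open>For (P + Q \<surd>2 + R \<surd>3 + S \<surd>6) / 2 the hypotheses say that the relative
  norm to \<rat>(\<surd>2) is integral. The first gives P and R equal parity; were both odd, it
  would force Q and S to have opposite parities, against the second.\<close>

lemma parity_integrality: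
  fixes P Q R S :: int
  assumes "4 dvd P\<^sup>2 + 2 * Q\<^sup>2 - 3 * R\<^sup>2 - 6 * S\<^sup>2" "2 dvd P * Q - 3 * (R * S)"
  shows "even P \<and> even R \<and> even (Q - S)"
proof -
  define m where "m = (\<lambda>x :: int. if even x then 0 else 1 :: int)"
  have "(P\<^sup>2 + 2 * Q\<^sup>2 - 3 * R\<^sup>2 - 6 * S\<^sup>2) mod 4 =
      (P\<^sup>2 mod 4 + 2 * (Q\<^sup>2 mod 4) - 3 * (R\<^sup>2 mod 4) - 6 * (S\<^sup>2 mod 4)) mod 4"
    by (intro mod_add_cong mod_diff_cong mod_mult_cong) simp_all
  also have "\<dots> = (m P + 2 * m Q - 3 * m R - 6 * m S) mod 4"
    unfolding square_mod_4 m_def ..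
  finally have m: "(m P + 2 * m Q - 3 * m R - 6 * m S) mod 4 = 0" using assms(1) by simp
  have "even (P * Q) = even (R * S)" using assms(2) by simp
  then have "(even P \<or> even Q) = (even R \<or> even S)" by simp
  then show ?thesis
    using m unfolding even_diff m_def
    by (cases "even P"; cases "even Q"; cases "even R"; cases "even S") simp_all
qed

text \<open>The sums of \<open>x\<close> with each of its conjugates, and its relative norm to \<open>\<rat>(\<surd>2)\<close>, are
  algebraic integers in quadratic fields; this bounds the denominators of the coordinates.\<close>

lemma K23_algebraic_int_int_comb:
  assumes "x \<in> K23" "algebraic_int x"
  obtains p r s t where "x = int_comb (sqrt 2) (sqrt 3) p r s t"
proof -
  obtain a b c d where x: "x = rat_comb (sqrt 2) (sqrt 3) a b c d" using assms(1) by (rule K23_rat_comb)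
  define y where "y = (\<lambda>u v. rat_comb u v a b c d)"
  have y: "algebraic_int (y u v)" if "conjugation u v" for u v
    using rat_comb_algebraic_int[of a b c d u v] that assms unfolding x y_def by blast
  define u v where "u = sqrt 2" "v = sqrt 3"
  have uv: "u\<^sup>2 = 2" "v\<^sup>2 = 3" "u * u = 2" "v * v = 3" "(u * v)\<^sup>2 = 6"
    by (simp_all add: u_v_def power_mult_distrib)
  have z: "algebraic_int (y u v)" "algebraic_int (y (- u) v)"
    "algebraic_int (y u (- v))" "algebraic_int (y (- u) (- v))"
    unfolding u_v_def by (rule y, simp)+
  have "2 * a \<in> \<int> \<and> 2 * b \<in> \<int>"
  proof (rule quadratic_algebraic_int[of 2 _ _ u])
    show "algebraic_int (of_rat (2 * a) + of_rat (2 * b) * u)"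
      using algebraic_int_add[OF z(1,3)] by (simp add: y_def rat_comb_def of_rat_mult mult_ac)
    show "algebraic_int (of_rat (2 * a) - of_rat (2 * b) * u)"
      using algebraic_int_add[OF z(2,4)] by (simp add: y_def rat_comb_def of_rat_mult mult_ac)
  qed (use uv in auto)
  moreover have "2 * a \<in> \<int> \<and> 2 * c \<in> \<int>"
  proof (rule quadratic_algebraic_int[of 3 _ _ v])
    show "algebraic_int (of_rat (2 * a) + of_rat (2 * c) * v)"
      using algebraic_int_add[OF z(1,2)] by (simp add: y_def rat_comb_def of_rat_mult mult_ac)
    show "algebraic_int (of_rat (2 * a) - of_rat (2 * c) * v)"
      using algebraic_int_add[OF z(3,4)] by (simp add: y_def rat_comb_def of_rat_mult mult_ac)
  qed (use uv in auto)
  moreover have "2 * a \<in> \<int> \<and> 2 * d \<in> \<int>"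
  proof (rule quadratic_algebraic_int[of 6 _ _ "u * v"])
    show "algebraic_int (of_rat (2 * a) + of_rat (2 * d) * (u * v))"
      using algebraic_int_add[OF z(1,4)] by (simp add: y_def rat_comb_def of_rat_mult mult_ac)
    show "algebraic_int (of_rat (2 * a) - of_rat (2 * d) * (u * v))"
      using algebraic_int_add[OF z(2,3)] by (simp add: y_def rat_comb_def of_rat_mult mult_ac)
  qed (use uv in auto)
  ultimately obtain P Q R S :: int where "2 * a = of_int P" "2 * b = of_int Q"
      "2 * c = of_int R" "2 * d = of_int S"
    by (elim conjE Ints_cases) blast
  then have abcd: "a = of_int P / 2" "b = of_int Q / 2" "c = of_int R / 2" "d = of_int S / 2"
    by auto
  have "a\<^sup>2 + 2 * b\<^sup>2 - 3 * c\<^sup>2 - 6 * d\<^sup>2 \<in> \<int> \<and> 2 * a * b - 6 * c * d \<in> \<int>"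
  proof (rule quadratic_algebraic_int[of 2 _ _ u])
    define e f where "e = a\<^sup>2 + 2 * b\<^sup>2 - 3 * c\<^sup>2 - 6 * d\<^sup>2" and "f = 2 * a * b - 6 * c * d"
    have y_rat_comb: "y u v = rat_comb u v a b c d" "y u (- v) = rat_comb u v a b (- c) (- d)"
      "y (- u) v = rat_comb u v a (- b) c (- d)" "y (- u) (- v) = rat_comb u v a (- b) (- c) d"
      by (simp_all add: y_def rat_comb_def of_rat_minus)
    have "y u v * y u (- v) = rat_comb u v e f 0 0" "y (- u) v * y (- u) (- v) = rat_comb u v e (- f) 0 0"
      unfolding y_rat_comb rat_comb_mult[OF uv(1,2)] e_def f_def by (simp_all add: power2_eq_square algebra_simps)
    then have "y u v * y u (- v) = of_rat e + of_rat f * u"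
      "y (- u) v * y (- u) (- v) = of_rat e - of_rat f * u"
      by (simp_all add: rat_comb_def of_rat_minus)
    then show "algebraic_int (of_rat (a\<^sup>2 + 2 * b\<^sup>2 - 3 * c\<^sup>2 - 6 * d\<^sup>2) + of_rat (2 * a * b - 6 * c * d) * u)"
      "algebraic_int (of_rat (a\<^sup>2 + 2 * b\<^sup>2 - 3 * c\<^sup>2 - 6 * d\<^sup>2) - of_rat (2 * a * b - 6 * c * d) * u)"
      unfolding e_def[symmetric] f_def[symmetric]
      using algebraic_int_mult[OF z(1,3)] algebraic_int_mult[OF z(2,4)] by simp_all
  qed (use uv in auto)
  then obtain w z where "a\<^sup>2 + 2 * b\<^sup>2 - 3 * c\<^sup>2 - 6 * d\<^sup>2 = of_int w" "2 * a * b - 6 * c * d = of_int z"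
    by (elim conjE Ints_cases) blast
  then have "of_int (P\<^sup>2 + 2 * Q\<^sup>2 - 3 * R\<^sup>2 - 6 * S\<^sup>2) = (of_int (4 * w) :: rat)"
    "of_int (P * Q - 3 * (R * S)) = (of_int (2 * z) :: rat)"
    unfolding abcd by (simp_all add: power_divide field_simps)
  then have "P\<^sup>2 + 2 * Q\<^sup>2 - 3 * R\<^sup>2 - 6 * S\<^sup>2 = 4 * w" "P * Q - 3 * (R * S) = 2 * z"
    by (simp_all only: of_int_eq_iff)
  then have "even P \<and> even R \<and> even (Q - S)"
    by (intro parity_integrality) simp_all
  then obtain p r t where prt: "P = 2 * p" "R = 2 * r" "Q - S = 2 * t" by blast
  \<comment> \<open>The odd part shared by \<open>Q\<close> and \<open>S\<close> is absorbed by
    \<theta>: (Q \<surd>2 + S \<surd>6) / 2 = S \<theta> + t \<surd>2.\<close>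
  then have "Q = 2 * t + S" by simp
  then have "x = int_comb (sqrt 2) (sqrt 3) p r S t"
    unfolding x int_comb_rat_comb rat_comb_sqrt_eq_iff abcd prt by simp
  then show thesis by (rule that)
qed

text \<open>\<theta> is the square root of 2 + \<surd>3.\<close>

lemma theta_algebraic_int: "algebraic_int ((sqrt 2 + sqrt 2 * sqrt 3) / 2)"
proof -
  let ?x = "(sqrt 2 + sqrt 2 * sqrt 3) / 2"
  have x2: "?x\<^sup>2 = 2 + sqrt 3"
    by (simp add: power_divide power2_sum power_mult_distrib mult.commute)
  have "algebraic_int (2 + sqrt 3)"
    by (intro algebraic_int_add algebraic_int_sqrt) (auto intro: int_imp_algebraic_int)
  then have "algebraic_int (sqrt (?x\<^sup>2))" unfolding x2 by (rule algebraic_int_sqrt)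
  then show ?thesis by simp
qed

text \<open>The converse of \<open>K23_algebraic_int_int_comb\<close>; together they make 1,
  \<surd>3, \<theta>, \<surd>2 an integral basis.\<close>

lemma int_comb_in_ring_of_integers: "int_comb (sqrt 2) (sqrt 3) p r s t \<in> ring_of_integers K23"
proof -
  have "inverse (of_int 2) \<in> K23"
    by (rule K23_closed(4)[OF K23_of_int]) simp
  moreover have "(sqrt 2 + sqrt 2 * sqrt 3) / 2 = (sqrt 2 + sqrt 2 * sqrt 3) * inverse (of_int 2)"
    by simp
  ultimately have "(sqrt 2 + sqrt 2 * sqrt 3) / 2 \<in> K23"
    by (simp only: K23_closed)
  then have "int_comb (sqrt 2) (sqrt 3) p r s t \<in> K23"
    unfolding int_comb_def by (intro K23_closed K23_of_int)
  moreover have "algebraic_int (int_comb (sqrt 2) (sqrt 3) p r s t)"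
    unfolding int_comb_def
    by (intro algebraic_int_add algebraic_int_mult theta_algebraic_int algebraic_int_sqrt
        int_imp_algebraic_int) auto
  ultimately show ?thesis by (simp add: ring_of_integers_def)
qed

section \<open>Exact arithmetic with integral coordinates\<close>

text \<open>Coordinates in the integral basis 1, \<surd>3, \<theta>, \<surd>2, which make the finite
  searches below computations with integers.\<close>

type_synonym quad = "int \<times> int \<times> int \<times> int"

fun quad_val :: "real \<Rightarrow> real \<Rightarrow> quad \<Rightarrow> real" where
  "quad_val u v (p, r, s, t) = int_comb u v p r s t"

text \<open>The multiplication table of the basis: \<theta> \<theta> = 2 + \<surd>3, \<surd>3
  \<theta> = \<theta> + \<surd>2, \<surd>2 \<theta> = 1 + \<surd>3, \<surd>2 \<surd>3 = 2 \<theta> -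
  \<surd>2.\<close>

fun quad_mult :: "quad \<Rightarrow> quad \<Rightarrow> quad" where
  "quad_mult (p, r, s, t) (p', r', s', t') =
    (p * p' + 3 * (r * r') + 2 * (s * s') + 2 * (t * t') + s * t' + t * s',
     p * r' + r * p' + s * s' + s * t' + t * s',
     p * s' + s * p' + r * s' + s * r' + 2 * (r * t' + t * r'),
     p * t' + t * p' + r * s' + s * r' - (r * t' + t * r'))"

fun quad_add :: "quad \<Rightarrow> quad \<Rightarrow> quad" where
  "quad_add (p, r, s, t) (p', r', s', t') = (p + p', r + r', s + s', t + t')"

fun quad_sub :: "quad \<Rightarrow> quad \<Rightarrow> quad" where
  "quad_sub (p, r, s, t) (p', r', s', t') = (p - p', r - r', s - s', t - t')"

lemma quad_val_add: "quad_val u v (quad_add x y) = quad_val u v x + quad_val u v y"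
  by (cases x; cases y) (simp add: int_comb_def algebra_simps add_divide_distrib)

lemma quad_val_sub: "quad_val u v (quad_sub x y) = quad_val u v x - quad_val u v y"
  by (cases x; cases y) (simp add: int_comb_def algebra_simps diff_divide_distrib add_divide_distrib)

context conjugation
begin

text \<open>Here \<open>w\<close> stands for the conjugate of \<theta>. Only the squares of
  \<open>u\<close> and \<open>v\<close> enter, so one table serves all four conjugations.\<close>

lemma int_comb_mult_aux:
  fixes p r s t p' r' s' t' :: real
  assumes w: "2 * w = u + u * v"
  shows "(p + r * v + s * w + t * u) * (p' + r' * v + s' * w + t' * u) =
    (p * p' + 3 * (r * r') + 2 * (s * s') + 2 * (t * t') + s * t' + t * s') +
    (p * r' + r * p' + s * s' + s * t' + t * s') * v +
    (p * s' + s * p' + r * s' + s * r' + 2 * (r * t' + t * r')) * w +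
    (p * t' + t * p' + r * s' + s * r' - (r * t' + t * r')) * u"
proof -
  have uu: "u * u = 2" "v * v = 3" using u v by (simp_all add: power2_eq_square)
  have w': "w = (u + u * v) / 2" using w by simp
  have prods: "u * v = 2 * w - u" "u * w = 1 + v" "v * w = w + u" "w * w = 2 + v"
  proof -
    show "u * v = 2 * w - u" using w by simp
    have "2 * (u * w) = u * (2 * w)" by simp
    also have "\<dots> = u * u + (u * u) * v" unfolding w by (simp add: algebra_simps)
    finally show uw: "u * w = 1 + v" using uu by simp
    have "2 * (v * w) = v * (2 * w)" by simp
    also have "\<dots> = u * v + u * (v * v)" unfolding w by (simp add: algebra_simps)
    finally show "v * w = w + u" using uu w by simp
    have "2 * (w * w) = (2 * w) * w" by simp
    also have "\<dots> = u * w + (u * w) * v" unfolding w by (simp add: algebra_simps)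
    also have "\<dots> = 1 + v + v + v * v" unfolding uw by (simp add: algebra_simps)
    finally show "w * w = 2 + v" using uu by simp
  qed
  have "(p + r * v + s * w + t * u) * (p' + r' * v + s' * w + t' * u) =
    p * p' + (p * r' + r * p') * v + (p * s' + s * p') * w + (p * t' + t * p') * u +
    (r * r') * (v * v) + (s * s') * (w * w) + (t * t') * (u * u) +
    (r * s' + s * r') * (v * w) + (r * t' + t * r') * (u * v) + (s * t' + t * s') * (u * w)"
    by (simp add: algebra_simps)
  then show ?thesis unfolding prods uu by (simp add: algebra_simps)
qed

lemma quad_val_mult: "quad_val u v (quad_mult x y) = quad_val u v x * quad_val u v y"
  by (cases x; cases y)
    (simp add: int_comb_def int_comb_mult_aux[of "(u + u * v) / 2", simplified])

lemma conj_at_quad_val: "conj_at u v (quad_val (sqrt 2) (sqrt 3) x) = quad_val u v x"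
  by (cases x) (simp add: int_comb_rat_comb conj_at_rat_comb)

end

lemma quad_val_eq_iff: "quad_val (sqrt 2) (sqrt 3) x = quad_val (sqrt 2) (sqrt 3) y \<longleftrightarrow> x = y"
  by (cases x; cases y) (auto simp: int_comb_rat_comb rat_comb_sqrt_eq_iff)

section \<open>Total nonnegativity and its trace tests\<close>

definition totally_nonneg :: "quad \<Rightarrow> bool" where
  "totally_nonneg x \<longleftrightarrow> (\<forall>u v. conjugation u v \<longrightarrow> quad_val u v x \<ge> 0)"

text \<open>The trace of \<open>x\<close> is \<open>4 * fst x\<close>.\<close>

lemma trace_nonneg:
  assumes "totally_nonneg x"
  shows "fst x \<ge> 0"
proof -
  let ?u = "sqrt 2" and ?v = "sqrt 3"
  obtain p r s t where x: "x = (p, r, s, t)" by (cases x)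
  have "0 \<le> quad_val ?u ?v x + quad_val (- ?u) ?v x + quad_val ?u (- ?v) x + quad_val (- ?u) (- ?v) x"
    using assms unfolding totally_nonneg_def by (intro add_nonneg_nonneg) auto
  also have "\<dots> = 4 * of_int p"
    by (simp add: x int_comb_def algebra_simps add_divide_distrib diff_divide_distrib)
  finally show ?thesis by (simp add: x)
qed

text \<open>A square factor keeps every conjugate nonnegative, so each \<open>s\<close> yields a
  necessary condition on \<open>x\<close> that is an integer inequality.\<close>

lemma trace_square_mult_nonneg:
  assumes "totally_nonneg x"
  shows "fst (quad_mult (quad_mult s s) x) \<ge> 0"
  using assms by (intro trace_nonneg) (simp add: totally_nonneg_def conjugation.quad_val_mult)

text \<open>The multipliers \<open>s\<close> for which the trace of \<open>s\<^sup>2 (m - b\<^sup>2)\<close> is tested.  They were found by computer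
  search; an \<open>s\<close> with one dominant conjugate detects that \<open>m - b\<^sup>2\<close> is negative there.\<close>

definition test_elements :: "quad list" where
  "test_elements = [(1, 0, 0, 0), (3, -2, -3, 4), (2, 1, -2, -1), (0, 1, 0, 1), (2, 1, 1, 0), (3, 2, -3, -1)]"

text \<open>The Cauchy-Schwarz condition on b = B(x, y), where m = Q(x) Q(y).\<close>

definition square_le :: "quad \<Rightarrow> quad \<Rightarrow> bool" where
  "square_le m b \<longleftrightarrow> totally_nonneg (quad_sub m (quad_mult b b))"

text \<open>Contains all \<open>b\<close> such that \<open>b\<^sup>2\<close> has trace at most \<open>4 * 9\<close>.\<close>

definition box :: "quad list" where
  "box = List.product [-3..3] (List.product [-1..1] (List.product [-2..2] [-2..2]))"

text \<open>A computable superset of the solutions of \<open>square_le m b\<close> when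
  \<open>fst m \<le> 9\<close>: the tests are necessary conditions, and surviving them proves
  nothing.\<close>

definition candidates :: "quad \<Rightarrow> quad list" where
  "candidates m = filter (\<lambda>b. list_all (\<lambda>s. fst (quad_mult (quad_mult s s) (quad_sub m (quad_mult b b))) \<ge> 0) test_elements) box"

lemma int_abs_le_if_square:
  fixes x :: int
  assumes "x\<^sup>2 \<le> c" "c < (k + 1)\<^sup>2" "k \<ge> 0"
  shows "\<bar>x\<bar> \<le> k"
proof (rule ccontr)
  assume "\<not> \<bar>x\<bar> \<le> k"
  then have "(k + 1)\<^sup>2 \<le> \<bar>x\<bar>\<^sup>2" using assms(3) by (intro power_mono) auto
  then show False using assms by simp
qed

lemma square_le_in_candidates:
  assumes "square_le m b" "fst m \<le> 9"
  shows "b \<in> set (candidates m)"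
proof -
  obtain p r s t where b: "b = (p, r, s, t)" by (cases b)
  have "fst (quad_sub m (quad_mult b b)) \<ge> 0"
    using assms(1) trace_nonneg by (auto simp: square_le_def)
  then have le: "p\<^sup>2 + 3 * r\<^sup>2 + 2 * s\<^sup>2 + 2 * t\<^sup>2 + 2 * (s * t) \<le> 9"
    using assms(2) by (cases m) (simp add: b power2_eq_square mult.commute)
  have st: "s\<^sup>2 + t\<^sup>2 + 2 * (s * t) \<ge> 0"
    using zero_le_power2[of "s + t"] by (simp add: power2_sum)
  \<comment> \<open>The cross term is controlled by \<open>2 * (2 * s\<^sup>2 + 2 * (s * t) + 2 *
    t\<^sup>2) = 3 * s\<^sup>2 + (s + 2 * t)\<^sup>2\<close> and its mirror image; this bounds both
    squares by 6.\<close>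
  have s2: "4 * s\<^sup>2 + 4 * (s * t) + t\<^sup>2 \<ge> 0" "s\<^sup>2 + 4 * (s * t) + 4 * t\<^sup>2 \<ge> 0"
    using zero_le_power2[of "2 * s + t"] zero_le_power2[of "s + 2 * t"]
    by (simp_all add: power2_sum power_mult_distrib)
  have nn: "p\<^sup>2 \<ge> 0" "r\<^sup>2 \<ge> 0" "s\<^sup>2 \<ge> 0" "t\<^sup>2 \<ge> 0" by simp_all
  have "p\<^sup>2 \<le> 9" "r\<^sup>2 \<le> 3" "s\<^sup>2 \<le> 6" "t\<^sup>2 \<le> 6"
    using le st s2 nn by linarith+
  then have "\<bar>p\<bar> \<le> 3" "\<bar>r\<bar> \<le> 1" "\<bar>s\<bar> \<le> 2" "\<bar>t\<bar> \<le> 2"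
    by (auto intro!: int_abs_le_if_square)
  then have "b \<in> set box"
    unfolding box_def b set_product set_upto by (intro SigmaI) (simp_all add: abs_le_iff)
  moreover have "fst (quad_mult (quad_mult s s) (quad_sub m (quad_mult b b))) \<ge> 0" for s
    using assms(1) by (intro trace_square_mult_nonneg) (simp add: square_le_def)
  ultimately show ?thesis by (simp add: candidates_def list_all_iff)
qed

text \<open>The five integers of the overview, in its order; the fourth equals 3 + \<surd>6.\<close>

definition witnesses :: "quad list" where
  "witnesses = [(1, 0, 0, 0), (2, 0, 1, 0), (3, 1, -1, -1), (3, 0, 2, -1), (3, -1, -1, 1)]"

text \<open>Ensures that \<open>box\<close> is large enough for every off-diagonal Gram entry.
  Diagonal entries are prescribed, and a square such as that of the third witness exceeds the
  bound.\<close>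

lemma witnesses_traces:
  "list_all (\<lambda>x. list_all (\<lambda>y. x = y \<or> fst (quad_mult x y) \<le> 9) witnesses) witnesses"
  by code_simp

text \<open>Makes eight of the ten off-diagonal Gram entries vanish; (2, 4) and (3, 4) are left to
  the determinant.\<close>

lemma witnesses_orthogonal:
  "list_all (\<lambda>(i, j). candidates (quad_mult (witnesses ! i) (witnesses ! j)) = [(0, 0, 0, 0)])
    [(0, 1), (0, 2), (0, 3), (0, 4), (1, 2), (1, 3), (1, 4), (2, 3)]"
  by code_simp

text \<open>With entries \<open>b\<close> and \<open>c\<close>, the Gram determinant of the last three vectors is
  \<open>\<beta>\<^sub>2 \<beta>\<^sub>3 \<beta>\<^sub>4 - b\<^sup>2 \<beta>\<^sub>3 - c\<^sup>2 \<beta>\<^sub>2\<close>.\<close>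

lemma witnesses_det_nonzero:
  "list_all (\<lambda>b. list_all (\<lambda>c.
      quad_add (quad_mult (quad_mult b b) (witnesses ! 3)) (quad_mult (quad_mult c c) (witnesses ! 2)) \<noteq>
        quad_mult (quad_mult (witnesses ! 2) (witnesses ! 3)) (witnesses ! 4))
    (candidates (quad_mult (witnesses ! 3) (witnesses ! 4)))) (candidates (quad_mult (witnesses ! 2) (witnesses ! 4)))"
  by code_simp

section \<open>Classical forms over the ring of integers\<close>

text \<open>Gaussian elimination, one coordinate per induction step: a pivot vector is used up to
  clear the coordinate, so vectors continue to outnumber coordinates.\<close>

lemma nontrivial_linear_relation:
  fixes g :: "'k \<Rightarrow> 'i \<Rightarrow> real"
  assumes "finite I" "finite S" "card I < card S"
  shows "\<exists>c. (\<exists>k\<in>S. c k \<noteq> 0) \<and> (\<forall>i\<in>I. (\<Sum>k\<in>S. c k * g k i) = 0)"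
  using assms
proof (induction I arbitrary: S g rule: finite_induct)
  case empty
  then obtain k where "k \<in> S" by fastforce
  then show ?case by (intro exI[of _ "\<lambda>_. 1"]) auto
next
  case (insert j I)
  show ?case
  proof (cases "\<exists>k0\<in>S. g k0 j \<noteq> 0")
    case False
    have "card I < card S" using insert.prems insert.hyps by simp
    from insert.IH[OF insert.prems(1) this, of g] show ?thesis using False by (auto intro!: sum.neutral)
  next
    case True
    then obtain k0 where k0: "k0 \<in> S" "g k0 j \<noteq> 0" by blast
    define S' where "S' = S - {k0}"
    \<comment> \<open>Coordinate \<open>j\<close> is cleared by subtracting a multiple of the pivot
      vector.\<close>
    define g' where "g' = (\<lambda>k i. g k i - g k j / g k0 j * g k0 i)"
    have S: "S = insert k0 S'" "k0 \<notin> S'" "finite S'" using k0 insert.prems by (auto simp: S'_def)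
    have "card I < card S'" using insert.prems insert.hyps S by simp
    from insert.IH[OF S(3) this, of g'] obtain c where
      c: "\<exists>k\<in>S'. c k \<noteq> 0" "\<forall>i\<in>I. (\<Sum>k\<in>S'. c k * g' k i) = 0" by blast
    \<comment> \<open>This pivot coefficient collects the subtracted multiples, so the relation for
      \<open>g'\<close> becomes one for \<open>g\<close>.\<close>
    define c0 where "c0 = - (\<Sum>k\<in>S'. c k * (g k j / g k0 j))"
    define d where "d = c(k0 := c0)"
    have dS': "(\<Sum>k\<in>S'. d k * g k i) = (\<Sum>k\<in>S'. c k * g k i)" for i
      using S by (intro sum.cong) (auto simp: d_def)
    have d: "(\<Sum>k\<in>S. d k * g k i) = (\<Sum>k\<in>S'. c k * g' k i)" for i
    proof -
      have "(\<Sum>k\<in>S. d k * g k i) = c0 * g k0 i + (\<Sum>k\<in>S'. c k * g k i)"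
        using S dS' by (simp add: d_def)
      also have "\<dots> = (\<Sum>k\<in>S'. c k * g' k i)"
        unfolding c0_def g'_def right_diff_distrib sum_subtractf mult_minus_left sum_distrib_right
        by (simp add: mult.assoc)
      finally show ?thesis .
    qed
    have "g' k j = 0" for k using k0 by (simp add: g'_def)
    then have "\<forall>i\<in>insert j I. (\<Sum>k\<in>S. d k * g k i) = 0"
      using c(2) by (simp add: d)
    moreover have "\<exists>k\<in>S. d k \<noteq> 0" using c(1) S by (auto simp: d_def)
    ultimately show ?thesis by blast
  qed
qed

text \<open>The polar form normalised by B(x, x) = Q(x). The division by 2 is what classicality must
  compensate.\<close>

definition bilin :: "nat \<Rightarrow> (nat \<Rightarrow> nat \<Rightarrow> real) \<Rightarrow> (nat \<Rightarrow> real) \<Rightarrow> (nat \<Rightarrow> real) \<Rightarrow> real" where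
  "bilin n a x y = (\<Sum>i=1..n. \<Sum>j=i..n. a i j * (x i * y j + x j * y i) / 2)"

lemma qform_eval_bilin: "qform_eval n a x = bilin n a x x"
  by (simp add: qform_eval_def bilin_def algebra_simps)

lemma bilin_commute: "bilin n a x y = bilin n a y x"
  by (simp add: bilin_def algebra_simps)

lemma bilin_add: "bilin n a (\<lambda>i. x i + y i) z = bilin n a x z + bilin n a y z"
  unfolding bilin_def sum.distrib[symmetric]
  by (intro sum.cong refl) (simp add: algebra_simps add_divide_distrib)

lemma bilin_scale: "bilin n a (\<lambda>i. c * x i) z = c * bilin n a x z"
  unfolding bilin_def sum_distrib_left by (intro sum.cong refl) (simp add: algebra_simps)

lemma bilin_zero: "(\<And>i. i \<in> {1..n} \<Longrightarrow> x i = 0) \<Longrightarrow> bilin n a x z = 0"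
  unfolding bilin_def by (intro sum.neutral ballI) simp

lemma bilin_sum:
  "finite S \<Longrightarrow> bilin n a (\<lambda>i. \<Sum>k\<in>S. c k * x k i) z = (\<Sum>k\<in>S. c k * bilin n a (x k) z)"
  by (induction S rule: finite_induct) (simp_all add: bilin_add bilin_scale bilin_zero)

lemma ring_of_integers_quad_val:
  assumes "x \<in> ring_of_integers K23"
  obtains q where "x = quad_val (sqrt 2) (sqrt 3) q"
proof -
  have "x \<in> K23" "algebraic_int x" using assms by (auto simp: ring_of_integers_def)
  then obtain p r s t where "x = int_comb (sqrt 2) (sqrt 3) p r s t" by (rule K23_algebraic_int_int_comb)
  then show thesis using that[of "(p, r, s, t)"] by simp
qed

lemma ring_of_integers_closed:
  assumes "x \<in> ring_of_integers K23" "y \<in> ring_of_integers K23"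
  shows "x + y \<in> ring_of_integers K23" "x * y \<in> ring_of_integers K23" "- x \<in> ring_of_integers K23"
  using assms by (auto simp: ring_of_integers_def K23_closed algebraic_int_add algebraic_int_mult)

lemma ring_of_integers_K23: "x \<in> ring_of_integers K23 \<Longrightarrow> x \<in> K23"
  by (simp add: ring_of_integers_def)

lemma ring_of_integers_sum: "(\<And>i. i \<in> A \<Longrightarrow> f i \<in> ring_of_integers K23) \<Longrightarrow> sum f A \<in> ring_of_integers K23"
proof (induction A rule: infinite_finite_induct)
  case (insert x F)
  then show ?case by (simp add: ring_of_integers_closed)
qed (simp_all add: ring_of_integers_def K23_zero)

locale classical_K23_form =
  fixes n :: nat and a :: "nat \<Rightarrow> nat \<Rightarrow> real"
  assumes form: "quadratic_form_over K23 n a"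
    and classical: "classical_form K23 n a"
    and posdef: "totally_positive_definite K23 n a"
begin

definition int_vec :: "(nat \<Rightarrow> real) \<Rightarrow> bool" where
  "int_vec x \<longleftrightarrow> (\<forall>i\<in>{1..n}. x i \<in> ring_of_integers K23)"

text \<open>Classicality enters here: off the diagonal half the coefficient is integral, and on the
  diagonal the two equal summands cancel the 2.\<close>

lemma bilin_in_ring_of_integers:
  assumes "int_vec x" "int_vec y"
  shows "bilin n a x y \<in> ring_of_integers K23"
  unfolding bilin_def
proof (intro ring_of_integers_sum)
  fix i j assume ij: "i \<in> {1..n}" "j \<in> {i..n}"
  then have xy: "x i \<in> ring_of_integers K23" "x j \<in> ring_of_integers K23"
    "y i \<in> ring_of_integers K23" "y j \<in> ring_of_integers K23"
    using assms by (auto simp: int_vec_def)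
  show "a i j * (x i * y j + x j * y i) / 2 \<in> ring_of_integers K23"
  proof (cases "i = j")
    case True
    have "a i i \<in> ring_of_integers K23" using form ij by (auto simp: quadratic_form_over_def)
    then have "a i i * (x i * y i) \<in> ring_of_integers K23" by (intro ring_of_integers_closed xy)
    then show ?thesis using True by simp
  next
    case False
    then have "1 \<le> i \<and> i < j \<and> j \<le> n" using ij by simp
    then obtain b where b: "b \<in> ring_of_integers K23" "a i j = 2 * b"
      using classical unfolding classical_form_def by blast
    then have "b * (x i * y j + x j * y i) \<in> ring_of_integers K23" by (intro ring_of_integers_closed xy)
    then show ?thesis using b by simp
  qed
qed

lemma conj_at_form_nonneg:
  assumes "conjugation u v" "int_vec x"
  shows "conj_at u v (bilin n a x x) \<ge> 0"
proof (cases "\<forall>i\<in>{1..n}. x i = 0")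
  case True
  then have "bilin n a x x = 0" by (intro bilin_zero) blast
  then show ?thesis using conjugation.conj_at_of_int[OF assms(1), of 0] by simp
next
  case False
  then have "totally_positive K23 (qform_eval n a x)"
    using posdef assms(2) unfolding totally_positive_definite_def int_vec_def by blast
  then show ?thesis
    using conjugation.conj_at_embedding[OF assms(1)]
    by (fastforce simp: totally_positive_def qform_eval_bilin)
qed

text \<open>Evaluating the form at \<open>Q(y) x - B(x, y) y\<close>.\<close>

lemma cauchy_schwarz:
  assumes "conjugation u v" "int_vec x" "int_vec y" "conj_at u v (bilin n a y y) > 0"
  shows "(conj_at u v (bilin n a x y))\<^sup>2 \<le> conj_at u v (bilin n a x x) * conj_at u v (bilin n a y y)"
proof -
  interpret conjugation u v by fact
  define Qx Qy B where "Qx = bilin n a x x" and "Qy = bilin n a y y" and "B = bilin n a x y"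
  have OK: "Qx \<in> ring_of_integers K23" "Qy \<in> ring_of_integers K23" "B \<in> ring_of_integers K23"
    using assms bilin_in_ring_of_integers by (auto simp: Qx_def Qy_def B_def)
  \<comment> \<open>\<open>z\<close> has integral coordinates, so positivity on integral vectors
    applies to it under every conjugation.\<close>
  define z where "z = (\<lambda>i. Qy * x i + (- B) * y i)"
  have "int_vec z"
    using assms(2,3) OK unfolding int_vec_def z_def by (intro ballI ring_of_integers_closed) auto
  then have "conj_at u v (bilin n a z z) \<ge> 0" by (rule conj_at_form_nonneg[OF assms(1)])
  also have "bilin n a z z = Qy * (Qx * Qy + - (B * B))"
  proof -
    have zl: "bilin n a z w = Qy * bilin n a x w - B * bilin n a y w" for w
      unfolding z_def bilin_add bilin_scale by simp
    have zx: "bilin n a x z = Qy * Qx - B * B" "bilin n a y z = Qy * B - B * Qy"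
      using zl[of x] zl[of y] unfolding bilin_commute[of n a x z] bilin_commute[of n a y z]
      by (simp_all add: Qx_def Qy_def B_def bilin_commute[of n a y x])
    show ?thesis unfolding zl[of z] zx by (simp add: algebra_simps)
  qed
  also have "conj_at u v \<dots> = conj_at u v Qy * (conj_at u v Qx * conj_at u v Qy + - (conj_at u v B * conj_at u v B))"
  proof -
    have *: "conj_at u v (- w) = - conj_at u v w" if "w \<in> K23" for w
      using conj_at_mult[OF K23_of_int[of "-1"] that] conj_at_of_int[of "-1"] by simp
    show ?thesis using OK[THEN ring_of_integers_K23] by (simp add: conj_at_mult conj_at_add K23_closed * del: add_uminus_conv_diff)
  qed
  finally show ?thesis
    using assms(4) by (simp add: zero_le_mult_iff Qx_def Qy_def B_def power2_eq_square)
qed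

lemma square_le_bilin:
  assumes "int_vec x" "int_vec y"
    and "bilin n a x x = quad_val (sqrt 2) (sqrt 3) p" "bilin n a y y = quad_val (sqrt 2) (sqrt 3) q"
    and "bilin n a x y = quad_val (sqrt 2) (sqrt 3) b"
    and "\<And>u v. conjugation u v \<Longrightarrow> quad_val u v q > 0"
  shows "square_le (quad_mult p q) b"
  unfolding square_le_def totally_nonneg_def
proof (intro allI impI)
  fix u v assume uv: "conjugation u v"
  interpret conjugation u v by fact
  have "(quad_val u v b)\<^sup>2 \<le> quad_val u v p * quad_val u v q"
    using cauchy_schwarz[OF uv assms(1,2)] assms(6)[OF uv] unfolding assms(3-5) conj_at_quad_val .
  then show "quad_val u v (quad_sub (quad_mult p q) (quad_mult b b)) \<ge> 0"
    by (simp add: quad_val_sub quad_val_mult power2_eq_square)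
qed

end

text \<open>An abstract homomorphism fixes the integers, so the images of \<surd>2 and \<surd>3
  determine it on integral combinations. This reduces total positivity to the four sign
  choices.\<close>

lemma embedding_quad_val:
  assumes "\<sigma> \<in> embeddings K23"
  obtains u v where "conjugation u v"
    "\<And>q. \<sigma> (quad_val (sqrt 2) (sqrt 3) q) = complex_of_real (quad_val u v q)"
proof -
  have hom: "\<sigma> (x + y) = \<sigma> x + \<sigma> y" "\<sigma> (x * y) = \<sigma> x * \<sigma> y" if "x \<in> K23" "y \<in> K23" for x y
    using ring_hom_add[OF assms[unfolded embeddings_def]] ring_hom_mult[OF assms[unfolded embeddings_def]]
      that by simp_all
  have one: "\<sigma> 1 = 1" using ring_hom_one[OF assms[unfolded embeddings_def]] by simp
  have zero: "\<sigma> 0 = 0" using hom(1)[OF K23_zero K23_zero] by simp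
  have nat: "\<sigma> (of_nat m) = of_nat m" for m
    by (induction m) (simp_all add: zero one hom K23_closed K23_of_nat)
  have int: "\<sigma> (of_int m) = of_int m" for m
  proof (cases m)
    case (neg k)
    have "\<sigma> (of_int m) + \<sigma> (of_nat (Suc k)) = \<sigma> (of_int m + of_nat (Suc k))"
      by (rule hom(1)[symmetric]) (rule K23_of_int K23_of_nat)+
    also have "\<dots> = 0" using neg zero by simp
    finally have "\<sigma> (of_int m) = - of_nat (Suc k)"
      unfolding nat by (simp only: eq_neg_iff_add_eq_0)
    then show ?thesis by (simp add: neg)
  qed (use nat in simp)
  \<comment> \<open>The image squares to \<open>m\<close> in the complex numbers, so it is one of
    the two real roots.\<close>
  have root: "\<exists>w. w\<^sup>2 = real m \<and> \<sigma> (sqrt (real m)) = complex_of_real w" if "sqrt (real m) \<in> K23" for m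
  proof -
    have "\<sigma> (sqrt (real m)) * \<sigma> (sqrt (real m)) = \<sigma> (real m)"
      using hom(2)[OF that that] by simp
    also have "\<dots> = complex_of_real (sqrt (real m)) * complex_of_real (sqrt (real m))"
      unfolding nat of_real_mult[symmetric] by simp
    finally have "\<sigma> (sqrt (real m)) = complex_of_real (sqrt (real m)) \<or>
        \<sigma> (sqrt (real m)) = complex_of_real (- sqrt (real m))"
      unfolding square_eq_iff by simp
    then show ?thesis by (auto intro: exI[of _ "sqrt (real m)"] exI[of _ "- sqrt (real m)"])
  qed
  obtain u where u: "u\<^sup>2 = 2" "\<sigma> (sqrt 2) = complex_of_real u"
    using root[of 2] K23_closed by auto
  obtain v where v: "v\<^sup>2 = 3" "\<sigma> (sqrt 3) = complex_of_real v"
    using root[of 3] K23_closed by auto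
  have "\<sigma> (quad_val (sqrt 2) (sqrt 3) q) = complex_of_real (quad_val u v q)" for q
  proof -
    obtain p r s t where q: "q = (p, r, s, t)" by (cases q)
    have e: "quad_val (sqrt 2) (sqrt 3) q \<in> K23"
      unfolding q quad_val.simps by (rule ring_of_integers_K23[OF int_comb_in_ring_of_integers])
    have mem: "of_int k * x \<in> K23" if "x \<in> K23" for k x
      using that by (intro K23_closed K23_of_int)
    note S2 = K23_closed(6) and S3 = K23_closed(7)
    \<comment> \<open>Doubling clears the denominator of \<theta>, leaving only ring operations on
      integers, \<surd>2 and \<surd>3.\<close>
    have "of_int 2 * \<sigma> (quad_val (sqrt 2) (sqrt 3) q) = \<sigma> (of_int 2 * quad_val (sqrt 2) (sqrt 3) q)"
      by (simp only: hom(2)[OF K23_of_int e] int)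
    also have "of_int 2 * quad_val (sqrt 2) (sqrt 3) q =
        of_int (2 * p) + of_int (2 * r) * sqrt 3 + of_int s * (sqrt 2 + sqrt 2 * sqrt 3) +
        of_int (2 * t) * sqrt 2"
      by (simp add: q int_comb_def algebra_simps add_divide_distrib)
    also have "\<sigma> \<dots> = of_int (2 * p) + of_int (2 * r) * \<sigma> (sqrt 3) +
        of_int s * (\<sigma> (sqrt 2) + \<sigma> (sqrt 2) * \<sigma> (sqrt 3)) + of_int (2 * t) * \<sigma> (sqrt 2)"
      using S2 S3 by (simp only: hom int K23_closed K23_of_int)
    also have "\<dots> = of_int 2 * complex_of_real (quad_val u v q)"
      by (simp add: q int_comb_def u v algebra_simps add_divide_distrib)
    finally show ?thesis by simp
  qed
  then show thesis using that[of u v] u v by (simp add: conjugation_def)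
qed

lemma totally_positive_quad_val:
  assumes "\<And>u v. conjugation u v \<Longrightarrow> quad_val u v q > 0"
  shows "quad_val (sqrt 2) (sqrt 3) q \<in> totally_positive_integers K23"
proof -
  have "quad_val (sqrt 2) (sqrt 3) q \<in> ring_of_integers K23"
    by (cases q) (simp add: int_comb_in_ring_of_integers)
  moreover have "totally_positive K23 (quad_val (sqrt 2) (sqrt 3) q)"
    unfolding totally_positive_def
  proof
    fix \<sigma> assume "\<sigma> \<in> embeddings K23"
    then obtain u v where "conjugation u v" "\<sigma> (quad_val (sqrt 2) (sqrt 3) q) = complex_of_real (quad_val u v q)"
      by (rule embedding_quad_val) blast
    then show "\<sigma> (quad_val (sqrt 2) (sqrt 3) q) \<in> \<real> \<and> 0 < Re (\<sigma> (quad_val (sqrt 2) (sqrt 3) q))"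
      using assms by simp
  qed
  ultimately show ?thesis by (simp add: totally_positive_integers_def)
qed

lemma witnesses_positive:
  assumes "conjugation u v" "q \<in> set witnesses"
  shows "quad_val u v q > 0"
proof -
  have sq: "x = y \<or> x = - y" if "x\<^sup>2 = y\<^sup>2" for x y :: real using that by (simp add: power2_eq_iff)
  have u: "u = sqrt 2 \<or> u = - sqrt 2" and v: "v = sqrt 3 \<or> v = - sqrt 3"
    using assms(1) by (auto simp: conjugation_def intro!: sq)
  have s6: "sqrt 2 * sqrt 3 = sqrt 6" by (simp add: real_sqrt_mult[symmetric])
  \<comment> \<open>Three decimals suffice: the smallest conjugate that occurs is 2 - \<theta>,
    about 0.07.\<close>
  have lower: "1.414 < sqrt 2" "1.732 < sqrt 3" "2.449 < sqrt 6"
    by (rule real_less_rsqrt, simp add: power2_eq_square)+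
  have upper: "sqrt 2 < 1.415" "sqrt 3 < 1.733" "sqrt 6 < 2.450"
    by (rule real_less_lsqrt, simp, simp, simp add: power2_eq_square)+
  show ?thesis
    using assms(2) u v lower upper by (elim disjE) (auto simp: witnesses_def int_comb_def s6 field_simps)
qed

theorem proposition5p3:
  fixes n :: nat and a :: "nat \<Rightarrow> nat \<Rightarrow> real"
  assumes "quadratic_form_over K23 n a"
    and "classical_form K23 n a"
    and "totally_positive_definite K23 n a"
    and "universal_form K23 n a"
  shows "n \<ge> 5"
proof (rule ccontr)
  assume "\<not> n \<ge> 5"
  then have n: "card {1..n} < card {..<5 :: nat}" by simp
  interpret classical_K23_form n a by unfold_locales fact+
  let ?quad_val = "quad_val (sqrt 2) (sqrt 3)"
  have in_witnesses: "witnesses ! k \<in> set witnesses" if "k < 5" for k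
    using that by (intro nth_mem) (simp add: witnesses_def)
  have "\<exists>x. int_vec x \<and> bilin n a x x = ?quad_val (witnesses ! k)" if "k < 5" for k
  proof -
    have "?quad_val (witnesses ! k) \<in> totally_positive_integers K23"
      by (rule totally_positive_quad_val) (rule witnesses_positive[OF _ in_witnesses[OF that]])
    then show ?thesis
      using assms(4) unfolding universal_form_def int_vec_def qform_eval_bilin by blast
  qed
  then obtain x where x: "\<And>k. k < 5 \<Longrightarrow> int_vec (x k)"
      "\<And>k. k < 5 \<Longrightarrow> bilin n a (x k) (x k) = ?quad_val (witnesses ! k)"
    by metis
  have cand: "\<exists>b \<in> set (candidates (quad_mult (witnesses ! k) (witnesses ! l))). bilin n a (x k) (x l) = ?quad_val b"
    if "k < l" "l < 5" for k l
  proof -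
    have kl: "k < 5" "l < 5" using that by simp_all
    obtain b where b: "bilin n a (x k) (x l) = ?quad_val b"
      using bilin_in_ring_of_integers x kl by (meson ring_of_integers_quad_val)
    have "square_le (quad_mult (witnesses ! k) (witnesses ! l)) b"
      by (rule square_le_bilin[OF x(1)[OF kl(1)] x(1)[OF kl(2)] x(2)[OF kl(1)] x(2)[OF kl(2)] b
            witnesses_positive[OF _ in_witnesses[OF kl(2)]]])
    moreover have "witnesses ! k \<noteq> witnesses ! l"
      using that by (subst nth_eq_iff_index_eq) (simp_all add: witnesses_def)
    then have "fst (quad_mult (witnesses ! k) (witnesses ! l)) \<le> 9"
      using witnesses_traces in_witnesses[OF kl(1)] in_witnesses[OF kl(2)] by (auto simp: list_all_iff)
    ultimately show ?thesis using b square_le_in_candidates by blast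
  qed
  \<comment> \<open>Five vectors with at most four coordinates are dependent. The coefficients are
    real, which suits \<open>bilin\<close>, as it is linear over the reals.\<close>
  obtain c where c: "\<exists>k\<in>{..<5::nat}. c k \<noteq> 0" "\<forall>i\<in>{1..n}. (\<Sum>k<5. c k * x k i) = 0"
    using nontrivial_linear_relation[of "{1..n}" "{..<5}" x, OF _ _ n] by auto
  define G where "G = (\<lambda>k l. bilin n a (x k) (x l))"
  have rel: "(\<Sum>k<5. c k * G k l) = 0" for l
    unfolding G_def using c(2) by (subst bilin_sum[symmetric]) (auto intro!: bilin_zero)
  have diag: "G k k > 0" if "k < 5" for k
    using witnesses_positive[OF sign_conjugation(1) in_witnesses[OF that]] x(2)[OF that] by (simp add: G_def)
  have "G k l = 0" if "(k, l) \<in> set [(0, 1), (0, 2), (0, 3), (0, 4), (1, 2), (1, 3), (1, 4), (2, 3)]" for k l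
  proof -
    have "k < l" "l < 5" using that by auto
    then obtain b where "b \<in> set (candidates (quad_mult (witnesses ! k) (witnesses ! l)))" "G k l = ?quad_val b"
      using cand unfolding G_def by blast
    moreover have "candidates (quad_mult (witnesses ! k) (witnesses ! l)) = [(0, 0, 0, 0)]"
      using witnesses_orthogonal that unfolding list_all_iff by blast
    ultimately show ?thesis by (simp add: int_comb_def)
  qed
  then have orth: "G 0 1 = 0" "G 0 2 = 0" "G 0 3 = 0" "G 0 4 = 0" "G 1 2 = 0" "G 1 3 = 0"
    "G 1 4 = 0" "G 2 3 = 0"
    by simp_all
  have sym: "G k l = G l k" for k l by (simp add: G_def bilin_commute)
  have orth': "G 1 0 = 0" "G 2 0 = 0" "G 3 0 = 0" "G 4 0 = 0" "G 2 1 = 0" "G 3 1 = 0"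
    "G 4 1 = 0" "G 3 2 = 0" "G 4 2 = G 2 4" "G 4 3 = G 3 4"
    using orth by (simp_all only: sym[of 1 0] sym[of 2 0] sym[of 3 0] sym[of 4 0] sym[of 2 1]
        sym[of 3 1] sym[of 4 1] sym[of 3 2] sym[of 4 2] sym[of 4 3])
  have expand: "c 0 * G 0 l + c 1 * G 1 l + c 2 * G 2 l + c 3 * G 3 l + c 4 * G 4 l = 0" for l
    using rel[of l] by (simp add: eval_nat_numeral)
  have c01: "c 0 = 0" "c 1 = 0"
    using expand[of 0] expand[of 1] orth orth' diag[of 0] diag[of 1] by auto
  have e2: "c 2 * G 2 2 = - (c 4 * G 2 4)" and e3: "c 3 * G 3 3 = - (c 4 * G 3 4)"
    and e4: "c 2 * G 2 4 + c 3 * G 3 4 + c 4 * G 4 4 = 0"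
    using expand[of 2] expand[of 3] expand[of 4] c01 orth orth'
    by auto
  have "c 4 \<noteq> 0"
  proof
    assume "c 4 = 0"
    then have "c 2 = 0" "c 3 = 0" using e2 e3 diag[of 2] diag[of 3] by auto
    then have "\<forall>k<5. c k = 0" using c01 \<open>c 4 = 0\<close> by (auto simp: eval_nat_numeral less_Suc_eq)
    then show False using c(1) by auto
  qed
  \<comment> \<open>Multiplying \<open>e4\<close> by \<open>G 2 2 * G 3 3\<close> and eliminating
    \<open>c 2\<close> and \<open>c 3\<close> leaves \<open>c 4\<close> times the Gram determinant
    of the last three vectors.\<close>
  have "c 4 * (G 2 4 * G 2 4 * G 3 3 + G 3 4 * G 3 4 * G 2 2) =
      - (c 2 * G 2 2) * G 2 4 * G 3 3 - (c 3 * G 3 3) * G 3 4 * G 2 2"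
    unfolding e2 e3 by (simp add: algebra_simps)
  also have "\<dots> = - (c 2 * G 2 4 + c 3 * G 3 4) * (G 2 2 * G 3 3)" by (simp add: algebra_simps)
  also have "\<dots> = c 4 * (G 2 2 * G 3 3 * G 4 4)"
    using e4 by (simp add: add_eq_0_iff[of _ "c 4 * G 4 4"] mult_ac eq_neg_iff_add_eq_0)
  finally have det: "G 2 4 * G 2 4 * G 3 3 + G 3 4 * G 3 4 * G 2 2 = G 2 2 * G 3 3 * G 4 4"
    using \<open>c 4 \<noteq> 0\<close> by simp
  obtain b where b: "b \<in> set (candidates (quad_mult (witnesses ! 2) (witnesses ! 4)))" "G 2 4 = ?quad_val b"
    using cand[of 2 4] unfolding G_def by auto
  obtain d where d: "d \<in> set (candidates (quad_mult (witnesses ! 3) (witnesses ! 4)))" "G 3 4 = ?quad_val d"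
    using cand[of 3 4] unfolding G_def by auto
  have diag_quad_val: "G k k = ?quad_val (witnesses ! k)" if "k < 5" for k using x(2)[OF that] by (simp add: G_def)
  interpret conjugation "sqrt 2" "sqrt 3" by simp
  \<comment> \<open>Coordinates are unique, so the vanishing determinant becomes an equation of
    integer quadruples, which the finite search excludes.\<close>
  have "?quad_val (quad_add (quad_mult (quad_mult b b) (witnesses ! 3)) (quad_mult (quad_mult d d) (witnesses ! 2))) =
      ?quad_val (quad_mult (quad_mult (witnesses ! 2) (witnesses ! 3)) (witnesses ! 4))"
    using det by (simp only: quad_val_add quad_val_mult b(2) d(2) diag_quad_val numeral_less_iff semiring_norm simp_thms)
  then have "quad_add (quad_mult (quad_mult b b) (witnesses ! 3)) (quad_mult (quad_mult d d) (witnesses ! 2)) =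
      quad_mult (quad_mult (witnesses ! 2) (witnesses ! 3)) (witnesses ! 4)"
    unfolding quad_val_eq_iff .
  then show False using witnesses_det_nonzero b(1) d(1) unfolding list_all_iff by blast
qed

end
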